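(* Let $M\in\mathbb{R}^{n\times n}$ be symmetric positive semidefinite with eigenvalues $\lambda_1\ge\dots\ge\lambda_n\ge0$, and let $F(P)=\|M-MP\|_F^2$. Let $P_\star=U_kU_k^\top$ be the orthogonal projector onto the span of the top $k$ eigenvectors of $M$. Then $P_\star$ minimizes $F(P)$ over all rank-$k$ orthogonal projectors $P\in\mathbb{R}^{n\times n}$, and $$F(P_\star)=\sum_{i=k+1}^n\lambda_i^2.$$
   Context: $\|\cdot\|_F$ is the Frobenius norm. $U_k\in\mathbb{R}^{n\times k}$ is the matrix whose columns are orthonormal eigenvectors $q_1,\dots,q_k$ of $M$ associated with $\lambda_1,\dots,\lambda_k$. An orthogonal projector is a matrix with $P^\top=P=P^2$. *)

theory Defs
  imports "Jordan_Normal_Form.Char_Poly" "Jordan_Normal_Form.DL_Rank"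
begin

definition frob_norm :: "real mat \<Rightarrow> real" where
  "frob_norm A = sqrt (\<Sum>i<dim_row A. \<Sum>j<dim_col A. (A $$ (i, j))\<^sup>2)"

definition sym_pos_semidef :: "nat \<Rightarrow> real mat \<Rightarrow> bool" where
  "sym_pos_semidef n M \<longleftrightarrow>
     M \<in> carrier_mat n n \<and> transpose_mat M = M \<and>
     (\<forall>x \<in> carrier_vec n. 0 \<le> x \<bullet> (M *\<^sub>v x))"

text \<open>The real numbers \<open>lam 1 \<ge> \<dots> \<ge> lam n\<close> are all the eigenvalues of \<open>M\<close>, listed with
  multiplicity: they are the roots of the characteristic polynomial.\<close>

definition ordered_eigenvalues :: "nat \<Rightarrow> real mat \<Rightarrow> (nat \<Rightarrow> real) \<Rightarrow> bool" where
  "ordered_eigenvalues n M lam \<longleftrightarrow>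
     char_poly M = (\<Prod>i = 1..n. [:- lam i, 1:]) \<and>
     (\<forall>i j. 1 \<le> i \<and> i \<le> j \<and> j \<le> n \<longrightarrow> lam j \<le> lam i)"

definition orthonormal_vecs :: "nat \<Rightarrow> nat \<Rightarrow> (nat \<Rightarrow> real vec) \<Rightarrow> bool" where
  "orthonormal_vecs n k q \<longleftrightarrow>
     (\<forall>i \<in> {1..k}. q i \<in> carrier_vec n) \<and>
     (\<forall>i \<in> {1..k}. \<forall>j \<in> {1..k}. q i \<bullet> q j = (if i = j then 1 else 0))"

definition orthogonal_projector :: "nat \<Rightarrow> real mat \<Rightarrow> bool" where
  "orthogonal_projector n P \<longleftrightarrow>
     P \<in> carrier_mat n n \<and> transpose_mat P = P \<and> P * P = P"

definition approx_error :: "real mat \<Rightarrow> real mat \<Rightarrow> real" where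
  "approx_error M P = (frob_norm (M - M * P))\<^sup>2"

end

theory Submission
  imports Defs "Jordan_Normal_Form.Schur_Decomposition"
begin

text \<open>For a symmetric \<open>M\<close> and an orthogonal projector \<open>P\<close> one has
  \<open>F(P) = tr(M\<^sup>2) - tr(M P M)\<close>. If \<open>M = W D W\<^sup>T\<close> with \<open>W\<close> orthogonal and
  \<open>G = W\<^sup>T P W\<close>, then \<open>tr(M P M)\<close> is the sum of the \<open>\<lambda>\<^sub>i\<^sup>2\<close> weighted by the diagonal entries
  of the projector \<open>G\<close>. These weights lie in \<open>[0, 1]\<close> and add up to \<open>tr(P) = k\<close>, so the
  weighted sum is at most \<open>\<lambda>\<^sub>1\<^sup>2 + \<dots> + \<lambda>\<^sub>k\<^sup>2\<close>, which is attained at \<open>P\<^sub>\<star>\<close>. The basis \<open>W\<close> need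
  not extend the given eigenvectors, because \<open>F(P\<^sub>\<star>)\<close> is computed from those directly.\<close>

section \<open>Traces, and the approximation error as a difference of traces\<close>

definition mat_trace :: "'a :: comm_monoid_add mat \<Rightarrow> 'a" where
  "mat_trace A = (\<Sum>i<dim_row A. A $$ (i, i))"

lemma index_mult_mat_sum:
  assumes "A \<in> carrier_mat n m" "B \<in> carrier_mat m p" "i < n" "j < p"
  shows "(A * B) $$ (i, j) = (\<Sum>l<m. A $$ (i, l) * B $$ (l, j))"
  using assms by (simp add: scalar_prod_def atLeast0LessThan)

lemma mat_trace_mult_comm:
  fixes A B :: "'a :: comm_semiring_0 mat"
  assumes A: "A \<in> carrier_mat n m" and B: "B \<in> carrier_mat m n"
  shows "mat_trace (A * B) = mat_trace (B * A)"
proof -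
  have "mat_trace (A * B) = (\<Sum>i<n. \<Sum>j<m. A $$ (i, j) * B $$ (j, i))"
    using A B unfolding mat_trace_def
    by (intro sum.cong) (auto simp: index_mult_mat_sum[OF A B] simp del: index_mult_mat(1))
  also have "\<dots> = (\<Sum>j<m. \<Sum>i<n. B $$ (j, i) * A $$ (i, j))"
    by (subst sum.swap) (simp add: mult.commute)
  also have "\<dots> = mat_trace (B * A)"
    using A B unfolding mat_trace_def
    by (intro sum.cong) (auto simp: index_mult_mat_sum[OF B A] simp del: index_mult_mat(1))
  finally show ?thesis .
qed

lemma mat_trace_diff:
  fixes A B :: "'a :: ab_group_add mat"
  assumes "A \<in> carrier_mat n n" "B \<in> carrier_mat n n"
  shows "mat_trace (A - B) = mat_trace A - mat_trace B"
  using assms by (simp add: mat_trace_def sum_subtractf)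

lemma mat_trace_one: "mat_trace (1\<^sub>m n) = (of_nat n :: 'a :: semiring_1)"
  by (simp add: mat_trace_def)

lemma frob_norm_squared:
  "(frob_norm A)\<^sup>2 = mat_trace (A * transpose_mat A)"
proof -
  have A: "A \<in> carrier_mat (dim_row A) (dim_col A)" by simp
  have AT: "transpose_mat A \<in> carrier_mat (dim_col A) (dim_row A)" by simp
  have "(frob_norm A)\<^sup>2 = (\<Sum>i<dim_row A. \<Sum>j<dim_col A. (A $$ (i, j))\<^sup>2)"
    unfolding frob_norm_def by (intro real_sqrt_pow2 sum_nonneg) auto
  also have "\<dots> = mat_trace (A * transpose_mat A)"
    unfolding mat_trace_def
    by (intro sum.cong) (auto simp: index_mult_mat_sum[OF A AT] power2_eq_square
        simp del: index_mult_mat(1))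
  finally show ?thesis .
qed

text \<open>By symmetry the transpose of \<open>M - M * P\<close> is \<open>M - P * M\<close>. In
  the expanded product, idempotence turns \<open>M P P M\<close> into \<open>M P M\<close>, which
  cancels one of the two cross terms.\<close>

lemma approx_error_projector:
  assumes M: "M \<in> carrier_mat n n" and sym: "transpose_mat M = M"
    and P: "orthogonal_projector n P"
  shows "approx_error M P = mat_trace (M * M) - mat_trace (M * P * M)"
proof -
  have Pc: "P \<in> carrier_mat n n" and PT: "transpose_mat P = P" and PP: "P * P = P"
    using P by (auto simp: orthogonal_projector_def)
  have MP: "M * P \<in> carrier_mat n n" and PM: "P * M \<in> carrier_mat n n"
    and MM: "M * M \<in> carrier_mat n n" and MPM: "M * P * M \<in> carrier_mat n n"
    using M Pc by auto
  have "transpose_mat (M - M * P) = M - P * M"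
    using M Pc by (subst transpose_minus) (auto simp: transpose_mult[of _ n n _ n] sym PT)
  moreover have "(M - M * P) * (M - P * M) = M * M - M * P * M"
  proof -
    have a: "M * (P * M) = M * P * M"
      using assoc_mult_mat[OF M Pc M] by simp
    have "P * (P * M) = P * M"
      using assoc_mult_mat[OF Pc Pc M] by (simp add: PP)
    then have b: "M * P * (P * M) = M * P * M"
      using assoc_mult_mat[OF M Pc PM] assoc_mult_mat[OF M Pc M] by simp
    have "(M - M * P) * (M - P * M) = M * (M - P * M) - M * P * (M - P * M)"
      using minus_mult_distrib_mat[OF M MP minus_carrier_mat[OF PM]] .
    also have "\<dots> = (M * M - M * P * M) - (M * P * M - M * P * M)"
      using mult_minus_distrib_mat[OF M M PM] mult_minus_distrib_mat[OF MP M PM] a b by simp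
    also have "\<dots> = M * M - M * P * M"
      using M Pc by (intro eq_matI) auto
    finally show ?thesis .
  qed
  ultimately show ?thesis
    unfolding approx_error_def frob_norm_squared
    using mat_trace_diff[OF MM MPM] by simp
qed

section \<open>Bounded weights and the sums they can produce\<close>

text \<open>For a symmetric idempotent, the diagonal entry p is the squared norm of its row. That
  row contains p itself, so p is nonnegative and p^2 is at most p.\<close>

lemma projector_diag_bounds:
  assumes "orthogonal_projector n P" "i < n"
  shows "0 \<le> P $$ (i, i)" "P $$ (i, i) \<le> 1"
proof -
  have P: "P \<in> carrier_mat n n" and PT: "transpose_mat P = P" and PP: "P * P = P"
    using assms(1) by (auto simp: orthogonal_projector_def)
  have sym: "P $$ (j, i) = P $$ (i, j)" if "j < n" for j
    using arg_cong[OF PT, of "\<lambda>A. A $$ (i, j)"] P assms(2) that by simp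
  have "P $$ (i, i) = (\<Sum>j<n. P $$ (i, j) * P $$ (j, i))"
    using index_mult_mat_sum[OF P P assms(2) assms(2)] by (simp only: PP)
  also have "\<dots> = (\<Sum>j<n. (P $$ (i, j))\<^sup>2)"
    by (intro sum.cong) (auto simp: sym power2_eq_square)
  finally have eq: "P $$ (i, i) = (\<Sum>j<n. (P $$ (i, j))\<^sup>2)" .
  show "0 \<le> P $$ (i, i)" unfolding eq by (intro sum_nonneg) auto
  have "(P $$ (i, i))\<^sup>2 \<le> (\<Sum>j<n. (P $$ (i, j))\<^sup>2)"
    by (rule member_le_sum) (use assms(2) in auto)
  then have "(P $$ (i, i))\<^sup>2 \<le> P $$ (i, i)" using eq by simp
  then show "P $$ (i, i) \<le> 1"
    by (cases "P $$ (i, i) \<le> 0") (auto simp: power2_eq_square)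
qed

text \<open>Compare \<open>d\<close> with the indicator \<open>e\<close> of the first
  \<open>k\<close> indices. The differences \<open>d i - e i\<close> sum to zero and are nonpositive
  before \<open>k\<close> and nonnegative from \<open>k\<close> on, so moving from \<open>e\<close>
  to \<open>d\<close> shifts weight towards smaller values of \<open>g\<close>.\<close>

lemma weighted_sum_le_sum_largest:
  fixes g d :: "nat \<Rightarrow> real"
  assumes anti: "\<And>i j. i \<le> j \<Longrightarrow> j < n \<Longrightarrow> g j \<le> g i"
    and d: "\<And>i. i < n \<Longrightarrow> 0 \<le> d i \<and> d i \<le> 1"
    and total: "(\<Sum>i<n. d i) = real k" and "k \<le> n"
  shows "(\<Sum>i<n. g i * d i) \<le> (\<Sum>i<k. g i)"
proof -
  define e where "e i = (if i < k then 1 else 0 :: real)" for i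
  have sum_e: "(\<Sum>i<n. h i * e i) = (\<Sum>i<k. h i)" for h :: "nat \<Rightarrow> real"
    by (rule sum.mono_neutral_cong_right) (use \<open>k \<le> n\<close> in \<open>auto simp: e_def\<close>)
  \<comment> \<open>The pivot \<open>g (k - 1)\<close> is the least of the \<open>k\<close> leading
    values. For \<open>k = 0\<close> it reads \<open>g 0\<close>, which still bounds every
    \<open>g i\<close> from above, and only the second case below occurs.\<close>
  have "(\<Sum>i<n. g i * (d i - e i)) \<le> (\<Sum>i<n. g (k - 1) * (d i - e i))"
  proof (intro sum_mono)
    fix i assume "i \<in> {..<n}"
    then have i: "i < n" by simp
    show "g i * (d i - e i) \<le> g (k - 1) * (d i - e i)"
    proof (cases "i < k")
      case True
      then have "g (k - 1) \<le> g i" using \<open>k \<le> n\<close> by (intro anti) auto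
      then show ?thesis using True d[OF i] by (auto simp: e_def intro: mult_right_mono_neg)
    next
      case False
      then have "g i \<le> g (k - 1)" using i by (intro anti) auto
      then show ?thesis using False d[OF i] by (auto simp: e_def intro: mult_right_mono)
    qed
  qed
  \<comment> \<open>The factor \<open>1\<close> lets \<open>sum_e\<close> apply with a constant
    \<open>h\<close>; both totals are then \<open>k\<close>.\<close>
  also have "\<dots> = g (k - 1) * ((\<Sum>i<n. d i) - (\<Sum>i<n. 1 * e i))"
    by (simp add: sum_distrib_left[symmetric] sum_subtractf)
  also have "\<dots> = 0" unfolding sum_e total by simp
  finally show ?thesis by (simp add: right_diff_distrib sum_subtractf sum_e)
qed

section \<open>Rank factorization and the trace of an idempotent\<close>

text \<open>The columns of \<open>B\<close> form a maximal independent set of columns of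
  \<open>A\<close>, and \<open>C\<close> holds the coordinates of all columns of \<open>A\<close> in
  it. The conclusions about \<open>cols B\<close> serve the idempotent case: independence allows
  cancelling \<open>B\<close>, and inclusion puts its columns in the range of
  \<open>A\<close>.\<close>

lemma (in vec_space) rank_factorization:
  assumes A: "A \<in> carrier_mat n nc"
  obtains B C where "B \<in> carrier_mat n (rank A)" "C \<in> carrier_mat (rank A) nc" "A = B * C"
    "distinct (cols B)" "lin_indpt (set (cols B))" "set (cols B) \<subseteq> set (cols A)"
proof -
  let ?X = "set (cols A)"
  have X: "?X \<subseteq> carrier_vec n" using A cols_dim by blast
  obtain S where S: "finite S" "maximal S (\<lambda>T. T \<subseteq> ?X \<and> lin_indpt T)"
    using maximal_exists_superset[of ?X "\<lambda>T. T \<subseteq> ?X \<and> lin_indpt T" "{}"]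
    by (auto simp: finite_lin_indpt2)
  have SX: "S \<subseteq> ?X" and ind: "lin_indpt S" using S(2) by (auto simp: maximal_def)
  have SC: "S \<subseteq> carrier_vec n" using SX X by blast
  \<comment> \<open>A column outside the span could be added to \<open>S\<close>, against
    maximality.\<close>
  have in_span: "x \<in> span S" if "x \<in> ?X" for x
  proof (rule ccontr)
    assume x: "x \<notin> span S"
    have "x \<notin> S" using x span_mem[OF SC] by blast
    moreover have "lin_indpt (insert x S)"
      using lin_dep_iff_in_span[OF SC ind _ \<open>x \<notin> S\<close>] that X x by auto
    ultimately show False using S(2) SX that unfolding maximal_def by blast
  qed
  have card: "rank A = card S" using rank_card_indpt[OF A S(2)] .
  obtain bs where bs: "set bs = S" "distinct bs" using finite_distinct_list[OF S(1)] by blast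
  have len: "length bs = rank A" using bs card distinct_card by fastforce
  define B where "B = mat_of_cols n bs"
  have B: "B \<in> carrier_mat n (rank A)" unfolding B_def using len by auto
  have colsB: "cols B = bs" unfolding B_def using bs SC by auto
  have "\<exists>c. c \<in> carrier_vec (rank A) \<and> B *\<^sub>v c = col A j" if "j < nc" for j
  proof -
    have "col A j \<in> ?X" using A that by (metis carrier_matD(2) cols_length cols_nth nth_mem)
    then have "col A j \<in> span (set (cols B))" using in_span by (simp add: colsB bs)
    then obtain a where a: "lincomb a (set (cols B)) = col A j"
      using finite_in_span[of "set (cols B)" "col A j"] colsB bs SC by auto
    have "B *\<^sub>v vec (rank A) (\<lambda>i. a (col B i)) = col A j"
      using mat_mult_eq_lincomb[OF B, of a] colsB bs(2) a by simp
    then show ?thesis by (metis vec_carrier)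
  qed
  then obtain c where c: "\<And>j. j < nc \<Longrightarrow> c j \<in> carrier_vec (rank A) \<and> B *\<^sub>v c j = col A j"
    by metis
  define C where "C = mat_of_cols (rank A) (map c [0..<nc])"
  have C: "C \<in> carrier_mat (rank A) nc" unfolding C_def by auto
  have "A = B * C"
  proof (rule mat_col_eqI)
    fix j assume "j < dim_col (B * C)"
    then have j: "j < nc" using C by auto
    have "col (B * C) j = B *\<^sub>v col C j" using col_mult2[OF B C j] .
    also have "col C j = c j" unfolding C_def using j c by (simp add: col_mat_of_cols)
    finally show "col A j = col (B * C) j" using c[OF j] by simp
  qed (use A B C in auto)
  then show thesis using that[OF B C] colsB bs ind SX by simp
qed

text \<open>A nonzero column of \<open>X - Y\<close> would be a nontrivial relation among the
  columns of \<open>B\<close>. Distinctness is stated separately because independence of a set does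
  not see repeated columns.\<close>

lemma (in vec_space) mult_left_cancel_indpt_cols:
  assumes B: "B \<in> carrier_mat n r" and "distinct (cols B)" "lin_indpt (set (cols B))"
    and X: "X \<in> carrier_mat r m" and Y: "Y \<in> carrier_mat r m" and eq: "B * X = B * Y"
  shows "X = Y"
proof (rule mat_col_eqI)
  fix j assume "j < dim_col Y"
  then have j: "j < m" using Y by auto
  have cX: "col X j \<in> carrier_vec r" and cY: "col Y j \<in> carrier_vec r" using X Y by auto
  have "B *\<^sub>v col X j = B *\<^sub>v col Y j"
    using eq B X Y j by (metis carrier_matD(2) col_mult2)
  then have "B *\<^sub>v (col X j - col Y j) = 0\<^sub>v n"
    using B cX cY by (simp add: mult_minus_distrib_mat_vec[of _ n r])
  then have "col X j - col Y j = 0\<^sub>v r"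
    using lin_depI[OF B _ _ _ assms(2)] assms(3) minus_carrier_vec[OF cX cY] by blast
  then show "col X j = col Y j"
    using cX cY X Y by (intro eq_vecI) (auto dest!: arg_cong[where f = "\<lambda>v. v $ _"] simp: vec_eq_iff)
qed (use X Y in auto)

text \<open>A rank factorization \<open>P = B C\<close> of an idempotent satisfies \<open>C B = 1\<close>, and
  \<open>tr (B C) = tr (C B)\<close>.\<close>

lemma (in vec_space) mat_trace_idempotent:
  assumes P: "P \<in> carrier_mat n n" and PP: "P * P = P"
  shows "mat_trace P = of_nat (rank P)"
proof -
  obtain B C where B: "B \<in> carrier_mat n (rank P)" and C: "C \<in> carrier_mat (rank P) n"
    and fact: "P = B * C"
    and ind: "distinct (cols B)" "lin_indpt (set (cols B))" and sub: "set (cols B) \<subseteq> set (cols P)"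
    using rank_factorization[OF P] by blast
  \<comment> \<open>Each column of \<open>B\<close> is a column of \<open>P\<close>, and
    \<open>P * P = P\<close> says that \<open>P\<close> fixes its own columns.\<close>
  have "P * B = B"
  proof (rule mat_col_eqI)
    fix j assume "j < dim_col B"
    then have j: "j < rank P" using B by auto
    have "col B j \<in> set (cols B)" using B j by (metis carrier_matD(2) cols_length cols_nth nth_mem)
    then obtain i where i: "i < n" "col B j = col P i"
      using sub P by (auto simp: cols_def)
    have "col (P * B) j = P *\<^sub>v col P i" using col_mult2[OF P B j] i by simp
    also have "\<dots> = col (P * P) i" using col_mult2[OF P P i(1)] by simp
    finally show "col (P * B) j = col B j" using i by (simp add: PP)
  qed (use P B in auto)
  then have "B * (C * B) = B * 1\<^sub>m (rank P)"
    using B C assoc_mult_mat[OF B C B] by (simp add: fact[symmetric])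
  then have "C * B = 1\<^sub>m (rank P)"
    using mult_left_cancel_indpt_cols[OF B ind] B C by (meson mult_carrier_mat one_carrier_mat)
  then have "mat_trace (B * C) = of_nat (rank P)"
    using mat_trace_mult_comm[OF B C] by (simp add: mat_trace_one)
  then show ?thesis using fact by simp
qed

section \<open>The spectral theorem for real symmetric matrices\<close>

text \<open>Complete \<open>v\<close> to a basis, apply Gram-Schmidt, which keeps the first vector,
  and normalize. Only the direction of the first column matters later, so its scale \<open>c\<close>
  stays unspecified.\<close>

lemma exists_orthogonal_mat_first_col:
  fixes v :: "real vec"
  assumes v: "v \<in> carrier_vec n" and v0: "v \<noteq> 0\<^sub>v n"
  obtains W c where "W \<in> carrier_mat n n" "transpose_mat W * W = 1\<^sub>m n" "col W 0 = c \<cdot>\<^sub>v v"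
proof -
  interpret cof_vec_space n "TYPE(real)" .
  define b where "b = basis_completion v"
  from basis_completion[OF v v0, folded b_def]
  have b: "set b \<subseteq> carrier_vec n" "distinct b" "\<not> lin_dep (set b)" "length b = n" "hd b = v"
    by auto
  have "n \<noteq> 0" using v v0 by auto
  then obtain vs where bv: "b = v # vs" using b by (cases b) auto
  define ws where "ws = gram_schmidt n b"
  have ws: "set ws \<subseteq> carrier_vec n" "corthogonal ws" "length ws = n"
    using gram_schmidt_result[OF b(1,2,3) ws_def] b(4) by auto
  have hdws: "hd ws = v" unfolding ws_def bv using v by simp
  define us where "us = map (\<lambda>w. (1 / sqrt (w \<bullet> w)) \<cdot>\<^sub>v w) ws"
  \<comment> \<open>For \<open>i = j\<close> the equivalence says that no vector has norm zero, so
    the scaling in \<open>us\<close> really normalizes.\<close>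
  have orth: "ws ! i \<bullet> ws ! j = 0 \<longleftrightarrow> i \<noteq> j" if "i < n" "j < n" for i j
    using corthogonalD[OF ws(2)] that ws(3) by simp
  define W where "W = mat_of_cols n us"
  have W: "W \<in> carrier_mat n n" unfolding W_def us_def using ws by auto
  have wsc: "ws ! i \<in> carrier_vec n" if "i < n" for i using ws that by auto
  have colW: "col W i = (1 / sqrt (ws ! i \<bullet> ws ! i)) \<cdot>\<^sub>v ws ! i" if "i < n" for i
    unfolding W_def us_def using that ws wsc by (simp add: col_mat_of_cols)
  have "transpose_mat W * W = 1\<^sub>m n"
  proof (rule eq_matI)
    fix i j assume "i < dim_row (1\<^sub>m n)" "j < dim_col (1\<^sub>m n)"
    then have ij: "i < n" "j < n" by auto
    have nonneg: "ws ! i \<bullet> ws ! i \<ge> 0"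
      by (auto simp: scalar_prod_def intro: sum_nonneg)
    have "(transpose_mat W * W) $$ (i, j) = col W i \<bullet> col W j" using W ij by simp
    also have "\<dots> = (1 / sqrt (ws ! i \<bullet> ws ! i)) * (1 / sqrt (ws ! j \<bullet> ws ! j)) * (ws ! i \<bullet> ws ! j)"
      using ij wsc by (simp add: colW smult_scalar_prod_distrib[of _ n] scalar_prod_smult_distrib[of _ n])
    also have "\<dots> = 1\<^sub>m n $$ (i, j)"
      using orth[OF ij] orth[OF ij(1) ij(1)] ij nonneg by (auto simp: field_simps)
    finally show "(transpose_mat W * W) $$ (i, j) = 1\<^sub>m n $$ (i, j)" .
  qed (use W in auto)
  moreover have "ws ! 0 = v" using hdws ws(3) \<open>n \<noteq> 0\<close> by (metis hd_conv_nth length_0_conv)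
  ultimately show thesis using that[OF W] colW[of 0] \<open>n \<noteq> 0\<close> by auto
qed

text \<open>Induction by deflation: split off a unit eigenvector for \<open>f 0\<close>, and
  diagonalize the symmetric block that remains on its orthogonal complement. The factored
  characteristic polynomial supplies the real eigenvalue and passes to the block with one factor
  removed.\<close>

theorem real_symmetric_diagonalization:
  fixes A :: "real mat"
  assumes "A \<in> carrier_mat n n" "transpose_mat A = A"
    and "char_poly A = (\<Prod>i<n. [:- f i, 1:])"
  shows "\<exists>W. W \<in> carrier_mat n n \<and> transpose_mat W * W = 1\<^sub>m n \<and>
    A = W * mat_diag n f * transpose_mat W"
  using assms
proof (induction n arbitrary: A f)
  case 0
  show ?case
    by (rule exI[of _ "1\<^sub>m 0"]) (use 0 in \<open>auto intro!: eq_matI\<close>)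
next
  case (Suc n A f)
  let ?N = "Suc n"
  note A = Suc.prems(1) and sym = Suc.prems(2)
  have cp: "char_poly A = [:- f 0, 1:] * (\<Prod>i<n. [:- f (Suc i), 1:])"
    unfolding Suc.prems(3) by (rule prod.lessThan_Suc_shift)
  have "eigenvalue A (f 0)"
    unfolding eigenvalue_root_char_poly[OF A] cp by simp
  then obtain v where v: "v \<in> carrier_vec ?N" "v \<noteq> 0\<^sub>v ?N" and ev: "A *\<^sub>v v = f 0 \<cdot>\<^sub>v v"
    using A unfolding eigenvalue_def eigenvector_def by auto
  obtain W c where W: "W \<in> carrier_mat ?N ?N" and WtW: "transpose_mat W * W = 1\<^sub>m ?N"
    and col0: "col W 0 = c \<cdot>\<^sub>v v"
    using exists_orthogonal_mat_first_col[OF v] by blast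
  have Wt: "transpose_mat W \<in> carrier_mat ?N ?N" using W by simp
  have WWt: "W * transpose_mat W = 1\<^sub>m ?N" using mat_mult_left_right_inverse[OF Wt W WtW] .
  define A' where "A' = transpose_mat W * (A * W)"
  have A': "A' \<in> carrier_mat ?N ?N" unfolding A'_def using A W by auto
  have symA': "transpose_mat A' = A'"
    unfolding A'_def using A W Wt sym
    by (simp add: transpose_mult[of _ ?N ?N _ ?N] assoc_mult_mat[of _ ?N ?N _ ?N _ ?N])
  have "A *\<^sub>v col W 0 = f 0 \<cdot>\<^sub>v col W 0"
    unfolding col0 using mult_mat_vec[OF A v(1)] ev by (simp add: smult_smult_assoc mult.commute)
  moreover have "col W 0 \<in> carrier_vec ?N" using W by (simp add: carrier_vecI)
  \<comment> \<open>The first column of \<open>W\<close> is fixed by \<open>A\<close> up to the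
    factor \<open>f 0\<close>, so in the basis \<open>W\<close> the first column of the matrix is
    \<open>f 0\<close> times the first unit vector. Symmetry gives the same for the first
    row.\<close>
  ultimately have "col A' 0 = f 0 \<cdot>\<^sub>v col (transpose_mat W * W) 0"
    unfolding A'_def
    using col_mult2[OF Wt mult_carrier_mat[OF A W], of 0] col_mult2[OF A W, of 0]
      col_mult2[OF Wt W, of 0] mult_mat_vec[OF Wt, of "col W 0"]
    by simp
  then have first_col: "A' $$ (i, 0) = (if i = 0 then f 0 else 0)" if "i < ?N" for i
    unfolding WtW using that A' by (auto dest!: arg_cong[where f = "\<lambda>v. v $ i"])
  have first_row: "A' $$ (0, i) = (if i = 0 then f 0 else 0)" if "i < ?N" for i
    using first_col[OF that] arg_cong[OF symA', of "\<lambda>B. B $$ (i, 0)"] A' that by simp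
  define A3 where "A3 = mat n n (\<lambda>(i, j). A' $$ (Suc i, Suc j))"
  define E :: "real mat" where "E = mat 1 1 (\<lambda>_. f 0)"
  have A3: "A3 \<in> carrier_mat n n" and E: "E \<in> carrier_mat 1 1" by (auto simp: A3_def E_def)
  have block: "A' = four_block_mat E (0\<^sub>m 1 n) (0\<^sub>m n 1) A3"
  proof (rule eq_matI)
    fix i j assume "i < dim_row (four_block_mat E (0\<^sub>m 1 n) (0\<^sub>m n 1) A3)"
      "j < dim_col (four_block_mat E (0\<^sub>m 1 n) (0\<^sub>m n 1) A3)"
    then have "i < ?N" "j < ?N" using A3 E by auto
    then show "A' $$ (i, j) = four_block_mat E (0\<^sub>m 1 n) (0\<^sub>m n 1) A3 $$ (i, j)"
      using first_col[of i] first_row[of j] A3 E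
      by (cases i; cases j) (auto simp: A3_def E_def)
  qed (use A' A3 E in auto)
  have symA3: "transpose_mat A3 = A3"
  proof (rule eq_matI)
    fix i j assume "i < dim_row A3" "j < dim_col A3"
    then have "i < n" "j < n" using A3 by auto
    then show "transpose_mat A3 $$ (i, j) = A3 $$ (i, j)"
      using arg_cong[OF symA', of "\<lambda>B. B $$ (Suc i, Suc j)"] A' by (simp add: A3_def)
  qed (use A3 in auto)
  have "similar_mat A' A"
    unfolding similar_mat_def
    by (intro exI, rule similar_mat_witI[of "transpose_mat W" W ?N])
      (use A A' W Wt WtW WWt in \<open>auto simp: A'_def\<close>)
  then have "char_poly A' = char_poly A" by (rule char_poly_similar)
  then have "char_poly A = char_poly E * char_poly A3"
    using char_poly_four_block_zeros_col[OF E _ A3, of "0\<^sub>m 1 n"] block by simp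
  moreover have "char_poly E = [:- f 0, 1:]"
    by (simp add: E_def char_poly_defs det_def sign_def)
  ultimately have "[:- f 0, 1:] * char_poly A3 = [:- f 0, 1:] * (\<Prod>i<n. [:- f (Suc i), 1:])"
    using cp by simp
  \<comment> \<open>The linear factor is nonzero and real polynomials have no zero divisors, so it
    cancels.\<close>
  then have "char_poly A3 = (\<Prod>i<n. [:- f (Suc i), 1:])"
    unfolding mult_cancel_left by simp
  then obtain V where V: "V \<in> carrier_mat n n" and VtV: "transpose_mat V * V = 1\<^sub>m n"
    and A3V: "A3 = V * mat_diag n (\<lambda>i. f (Suc i)) * transpose_mat V"
    using Suc.IH[OF A3 symA3, of "\<lambda>i. f (Suc i)"] by blast
  let ?D = "mat_diag n (\<lambda>i. f (Suc i))"
  \<comment> \<open>\<open>Z\<close> extends \<open>V\<close> by the identity on the split-off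
    coordinate; \<open>W * Z\<close> will diagonalize \<open>A\<close>.\<close>
  define Z where "Z = four_block_mat (1\<^sub>m 1) (0\<^sub>m 1 n) (0\<^sub>m n 1) V"
  have Z: "Z \<in> carrier_mat ?N ?N" unfolding Z_def using V by auto
  have Zt: "transpose_mat Z = four_block_mat (1\<^sub>m 1) (0\<^sub>m 1 n) (0\<^sub>m n 1) (transpose_mat V)"
    unfolding Z_def using V by (subst transpose_four_block_mat[of _ 1 1 _ n _ n]) auto
  have Zt': "transpose_mat Z \<in> carrier_mat ?N ?N" using Z by simp
  have Vt: "transpose_mat V \<in> carrier_mat n n" using V by simp
  have ZtZ: "transpose_mat Z * Z = 1\<^sub>m ?N"
    unfolding Zt unfolding Z_def using V Vt VtV
    by (subst mult_four_block_mat[of _ 1 1 _ n _ n _ _ 1 _ n]) auto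
  have D: "mat_diag ?N f = four_block_mat E (0\<^sub>m 1 n) (0\<^sub>m n 1) ?D"
  proof (rule eq_matI)
    fix i j assume "i < dim_row (four_block_mat E (0\<^sub>m 1 n) (0\<^sub>m n 1) ?D)"
      "j < dim_col (four_block_mat E (0\<^sub>m 1 n) (0\<^sub>m n 1) ?D)"
    then show "mat_diag ?N f $$ (i, j) = four_block_mat E (0\<^sub>m 1 n) (0\<^sub>m n 1) ?D $$ (i, j)"
      using E by (cases i; cases j) (auto simp: mat_diag_def E_def)
  qed (use E in \<open>auto simp: mat_diag_def\<close>)
  have DN: "mat_diag ?N f \<in> carrier_mat ?N ?N" by simp
  have ZD: "Z * mat_diag ?N f = four_block_mat E (0\<^sub>m 1 n) (0\<^sub>m n 1) (V * ?D)"
    unfolding D Z_def using V E left_mult_zero_mat[of ?D n n 1]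
    by (subst mult_four_block_mat[of _ 1 1 _ n _ n _ _ 1 _ n]) auto
  have VD: "V * ?D \<in> carrier_mat n n" using V by (rule mult_carrier_mat) simp
  have VDV: "V * ?D * transpose_mat V \<in> carrier_mat n n" using VD Vt by (rule mult_carrier_mat)
  have A'Z: "A' = Z * mat_diag ?N f * transpose_mat Z"
    unfolding ZD Zt block A3V
    using mult_four_block_mat[OF E zero_carrier_mat zero_carrier_mat VD one_carrier_mat
        zero_carrier_mat zero_carrier_mat Vt]
    by (simp add: right_mult_one_mat[OF E] right_mult_zero_mat[OF VD] right_mult_zero_mat[OF E]
        left_mult_zero_mat[OF Vt] left_add_zero_mat[OF VDV] right_add_zero_mat[OF E]
        del: One_nat_def)
  have WZ: "W * Z \<in> carrier_mat ?N ?N" using W Z by simp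
  have WZt: "transpose_mat (W * Z) = transpose_mat Z * transpose_mat W"
    using transpose_mult[OF W Z] .
  note assoc = assoc_mult_mat[of _ ?N ?N _ ?N _ ?N]
  have "transpose_mat (W * Z) * (W * Z) = transpose_mat Z * (transpose_mat W * W) * Z"
    unfolding WZt using W Z Wt Zt' by (simp add: assoc)
  then have orth: "transpose_mat (W * Z) * (W * Z) = 1\<^sub>m ?N"
    using Zt' by (simp add: WtW ZtZ)
  have "W * A' * transpose_mat W = (W * transpose_mat W) * A * (W * transpose_mat W)"
    unfolding A'_def using A W Wt by (simp add: assoc)
  then have "A = W * A' * transpose_mat W" using A by (simp add: WWt)
  also have "\<dots> = (W * Z) * mat_diag ?N f * transpose_mat (W * Z)"
    unfolding A'Z WZt using W Z Wt Zt' DN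
    by (simp add: assoc mult_carrier_mat[of _ ?N ?N _ ?N])
  finally show ?case using WZ orth by blast
qed

section \<open>Projectors and traces in an eigenbasis\<close>

lemma mat_trace_orthogonal_conj:
  fixes X :: "'a :: comm_semiring_1 mat"
  assumes W: "W \<in> carrier_mat n n" and "transpose_mat W * W = 1\<^sub>m n" and X: "X \<in> carrier_mat n n"
  shows "mat_trace (W * X * transpose_mat W) = mat_trace X"
proof -
  have Wt: "transpose_mat W \<in> carrier_mat n n" using W by simp
  have "mat_trace (W * X * transpose_mat W) = mat_trace (transpose_mat W * (W * X))"
    using mat_trace_mult_comm[of "W * X" n n "transpose_mat W"] W X by simp
  also have "\<dots> = mat_trace X"
    using assoc_mult_mat[OF Wt W X] assms(2) X by simp
  finally show ?thesis .
qed

text \<open>With D the diagonal factor and \<open>G\<close> the matrix of \<open>P\<close> in the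
  basis \<open>W\<close>, the trace of \<open>M P M\<close> is that of D G D, where each diagonal
  entry of \<open>G\<close> is scaled by \<open>f i\<close> from both sides.\<close>

lemma mat_trace_diagonalized:
  fixes M :: "real mat"
  assumes W: "W \<in> carrier_mat n n" and WtW: "transpose_mat W * W = 1\<^sub>m n"
    and M: "M = W * mat_diag n f * transpose_mat W" and P: "P \<in> carrier_mat n n"
  shows "mat_trace (M * P * M) = (\<Sum>i<n. (f i)\<^sup>2 * (transpose_mat W * P * W) $$ (i, i))"
proof -
  let ?D = "mat_diag n f"
  define G where "G = transpose_mat W * P * W"
  have Wt: "transpose_mat W \<in> carrier_mat n n" and D: "?D \<in> carrier_mat n n" using W by auto
  have G: "G \<in> carrier_mat n n" unfolding G_def using W P by auto
  have DG: "?D * G * ?D = mat n n (\<lambda>(i, j). f i * G $$ (i, j) * f j)"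
    using G by (auto simp: mat_diag_mult_left[OF G] mat_diag_mult_right[of _ n n] intro!: eq_matI)
  have "M * P * M = W * (?D * G * ?D) * transpose_mat W"
    unfolding M G_def using W Wt D P
    by (simp add: assoc_mult_mat[of _ n n _ n _ n] mult_carrier_mat[of _ n n _ n])
  then have "mat_trace (M * P * M) = mat_trace (?D * G * ?D)"
    using mat_trace_orthogonal_conj[OF W WtW mult_carrier_mat[OF mult_carrier_mat[OF D G] D]]
    by (simp only:)
  also have "\<dots> = (\<Sum>i<n. (f i)\<^sup>2 * G $$ (i, i))"
    unfolding DG by (simp add: mat_trace_def power2_eq_square mult_ac)
  finally show ?thesis unfolding G_def .
qed

text \<open>A change to the basis \<open>W\<close> keeps both facts needed of the weights: a
  projector's diagonal lies in [0, 1], and its sum is the trace.\<close>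

lemma orthogonal_projector_conj:
  assumes W: "W \<in> carrier_mat n n" and "transpose_mat W * W = 1\<^sub>m n"
    and P: "orthogonal_projector n P"
  shows "orthogonal_projector n (transpose_mat W * P * W)"
    and "mat_trace (transpose_mat W * P * W) = mat_trace P"
proof -
  have Wt: "transpose_mat W \<in> carrier_mat n n" using W by simp
  have WWt: "W * transpose_mat W = 1\<^sub>m n" using mat_mult_left_right_inverse[OF Wt W assms(2)] .
  have Pc: "P \<in> carrier_mat n n" and PT: "transpose_mat P = P" and PP: "P * P = P"
    using P by (auto simp: orthogonal_projector_def)
  note assoc = assoc_mult_mat[of _ n n _ n _ n]
  have "transpose_mat W * P * W * (transpose_mat W * P * W)
      = transpose_mat W * P * (W * transpose_mat W) * P * W"
    using W Wt Pc by (simp add: assoc)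
  also have "\<dots> = transpose_mat W * (P * P) * W"
    unfolding WWt using W Wt Pc by (simp add: assoc)
  finally show "orthogonal_projector n (transpose_mat W * P * W)"
    using W Wt Pc
    by (simp add: orthogonal_projector_def PP PT transpose_mult[of _ n n _ n] assoc)
  show "mat_trace (transpose_mat W * P * W) = mat_trace P"
    using mat_trace_orthogonal_conj[of "transpose_mat W" n P] Wt WWt Pc by simp
qed

text \<open>The rank is read off from the trace: it equals tr(U U^T) = tr(U^T U) = k.\<close>

lemma orthonormal_cols_projector:
  fixes U :: "real mat"
  assumes U: "U \<in> carrier_mat n k" and UtU: "transpose_mat U * U = 1\<^sub>m k"
  shows "orthogonal_projector n (U * transpose_mat U)" "vec_space.rank n (U * transpose_mat U) = k"
proof -
  have Ut: "transpose_mat U \<in> carrier_mat k n" using U by simp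
  have UUt: "U * transpose_mat U \<in> carrier_mat n n" using U by simp
  have "U * transpose_mat U * (U * transpose_mat U) = U * ((transpose_mat U * U) * transpose_mat U)"
    using assoc_mult_mat[OF U Ut UUt] assoc_mult_mat[OF Ut U Ut] by simp
  also have "\<dots> = U * transpose_mat U" using Ut by (simp add: UtU)
  finally have idem: "U * transpose_mat U * (U * transpose_mat U) = U * transpose_mat U" .
  then show "orthogonal_projector n (U * transpose_mat U)"
    using UUt transpose_mult[OF U Ut] by (simp add: orthogonal_projector_def)
  have "real (vec_space.rank n (U * transpose_mat U)) = mat_trace (U * transpose_mat U)"
    using vec_space.mat_trace_idempotent[OF UUt idem] by simp
  also have "\<dots> = real k"
    using mat_trace_mult_comm[OF U Ut] by (simp add: UtU mat_trace_one)
  finally show "vec_space.rank n (U * transpose_mat U) = k" by simp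
qed

text \<open>With D = \<open>mat_diag k g\<close>, the product is (U D)(D U^T); cyclicity of the
  trace brings U^T U = 1 together and leaves tr(D^2).\<close>

lemma mat_trace_eigenvector_projector:
  fixes M U :: "real mat"
  assumes M: "M \<in> carrier_mat n n" and sym: "transpose_mat M = M"
    and U: "U \<in> carrier_mat n k" and UtU: "transpose_mat U * U = 1\<^sub>m k"
    and MU: "M * U = U * mat_diag k g"
  shows "mat_trace (M * (U * transpose_mat U) * M) = (\<Sum>i<k. (g i)\<^sup>2)"
proof -
  let ?D = "mat_diag k g"
  have Ut: "transpose_mat U \<in> carrier_mat k n" using U by simp
  have D: "?D \<in> carrier_mat k k" by simp
  have UD: "U * ?D \<in> carrier_mat n k" using U by simp
  have Dt: "transpose_mat ?D = ?D" by (auto simp: mat_diag_def intro!: eq_matI)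
  have UtM: "transpose_mat U * M = ?D * transpose_mat U"
    using transpose_mult[OF M U] transpose_mult[OF U D] by (simp add: MU sym Dt)
  have "M * (U * transpose_mat U) * M = (M * U) * (transpose_mat U * M)"
    using assoc_mult_mat[OF M U Ut] assoc_mult_mat[OF _ Ut M, of "M * U" n] mult_carrier_mat[OF M U]
    by simp
  also have "\<dots> = (U * ?D) * (?D * transpose_mat U)" unfolding MU UtM ..
  finally have "mat_trace (M * (U * transpose_mat U) * M) = mat_trace (?D * transpose_mat U * (U * ?D))"
    using mat_trace_mult_comm[OF UD mult_carrier_mat[OF D Ut]] by (simp only:)
  also have "?D * transpose_mat U * (U * ?D) = ?D * ((transpose_mat U * U) * ?D)"
    using assoc_mult_mat[OF D Ut UD] assoc_mult_mat[OF Ut U D] by simp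
  also have "\<dots> = mat_diag k (\<lambda>i. g i * g i)" by (simp add: UtU left_mult_one_mat[OF D])
  finally show ?thesis by (simp add: mat_trace_def mat_diag_def power2_eq_square)
qed

text \<open>Evaluate the quadratic form at an eigenvector. Nonnegativity is what lets squaring
  preserve the order of the eigenvalues.\<close>

lemma sym_pos_semidef_eigenvalue_nonneg:
  assumes "sym_pos_semidef n M" "eigenvalue M a"
  shows "0 \<le> a"
proof -
  have M: "M \<in> carrier_mat n n" using assms(1) by (simp add: sym_pos_semidef_def)
  obtain v where v: "v \<in> carrier_vec n" "v \<noteq> 0\<^sub>v n" "M *\<^sub>v v = a \<cdot>\<^sub>v v"
    using assms(2) M unfolding eigenvalue_def eigenvector_def by auto
  have "0 \<le> v \<bullet> (M *\<^sub>v v)" using assms(1) v(1) by (simp add: sym_pos_semidef_def)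
  then have "0 \<le> a * (v \<bullet> v)" using v by simp
  moreover have "v \<bullet> v > 0"
    using v conjugate_square_greater_0_vec[OF v(1)] by simp
  ultimately show ?thesis by (simp add: zero_le_mult_iff)
qed

section \<open>Optimality of the top eigenvector projector and its error\<close>

theorem corollary3p4:
  fixes n k :: nat
    and M U P_star :: "real mat"
    and lam :: "nat \<Rightarrow> real"
    and q :: "nat \<Rightarrow> real vec"
  assumes "k \<le> n"
    and "sym_pos_semidef n M"
    and "ordered_eigenvalues n M lam"
    and "orthonormal_vecs n k q"
    and "\<And>i. i \<in> {1..k} \<Longrightarrow> eigenvector M (q i) (lam i)"
    and "U = mat_of_cols n (map q [1..<Suc k])"
    and "P_star = U * transpose_mat U"
  shows "is_arg_min (approx_error M)
           (\<lambda>P. orthogonal_projector n P \<and> vec_space.rank n P = k) P_star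
         \<and> approx_error M P_star = (\<Sum>i = k + 1..n. (lam i)\<^sup>2)"
proof -
  \<comment> \<open>Eigenvalues are numbered from 1, matrix indices from 0.\<close>
  define f where "f i = lam (Suc i)" for i
  have M: "M \<in> carrier_mat n n" and sym: "transpose_mat M = M"
    using assms(2) by (auto simp: sym_pos_semidef_def)
  have cp: "char_poly M = (\<Prod>i<n. [:- f i, 1:])"
    using assms(3) unfolding ordered_eigenvalues_def f_def
    by (simp add: prod.atLeast1_atMost_eq lessThan_atLeast0)
  have f_nonneg: "0 \<le> f i" if "i < n" for i
  proof (rule sym_pos_semidef_eigenvalue_nonneg[OF assms(2)])
    show "eigenvalue M (f i)"
      unfolding eigenvalue_root_char_poly[OF M] cp poly_prod using that by (auto simp: prod_zero_iff)
  qed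
  have f_anti: "f j \<le> f i" if "i \<le> j" "j < n" for i j
    using assms(3) that by (auto simp: ordered_eigenvalues_def f_def)
  have f2_anti: "(f j)\<^sup>2 \<le> (f i)\<^sup>2" if "i \<le> j" "j < n" for i j
    using f_anti[OF that] f_nonneg[OF that(2)] by (intro power_mono)
  obtain W where W: "W \<in> carrier_mat n n" and WtW: "transpose_mat W * W = 1\<^sub>m n"
    and MW: "M = W * mat_diag n f * transpose_mat W"
    using real_symmetric_diagonalization[OF M sym cp] by blast
  \<comment> \<open>The case \<open>P = 1\<close> of the trace formula, where all weights are
    1.\<close>
  have trMM: "mat_trace (M * M) = (\<Sum>i<n. (f i)\<^sup>2)"
    using mat_trace_diagonalized[OF W WtW MW, of "1\<^sub>m n"] M W
    by (simp add: WtW right_mult_one_mat[of _ n n])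
  have tail: "(\<Sum>i<n. (f i)\<^sup>2) - (\<Sum>i<k. (f i)\<^sup>2) = (\<Sum>i = k + 1..n. (lam i)\<^sup>2)"
  proof -
    have "(\<Sum>i<n. (f i)\<^sup>2) = (\<Sum>i<k. (f i)\<^sup>2) + (\<Sum>i=k..<n. (f i)\<^sup>2)"
      using sum.atLeastLessThan_concat[of 0 k n "\<lambda>i. (f i)\<^sup>2"] assms(1)
      by (simp add: lessThan_atLeast0)
    moreover have "(\<Sum>i=k..<n. (f i)\<^sup>2) = (\<Sum>i = k + 1..n. (lam i)\<^sup>2)"
      unfolding f_def using sum.shift_bounds_Suc_ivl[of "\<lambda>i. (lam i)\<^sup>2" k n]
      by (simp add: atLeastLessThanSuc_atLeastAtMost)
    ultimately show ?thesis by simp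
  qed
  have U: "U \<in> carrier_mat n k" unfolding assms(6) by (metis mat_of_cols_carrier(1) length_map length_upt diff_Suc_1)
  have qc: "q (Suc i) \<in> carrier_vec n" if "i < k" for i
    using assms(4) that by (simp add: orthonormal_vecs_def)
  have colU: "col U i = q (Suc i)" if "i < k" for i
    unfolding assms(6) using that qc[OF that]
    by (subst col_mat_of_cols) (auto simp del: upt_Suc)
  have UtU: "transpose_mat U * U = 1\<^sub>m k"
    using U assms(4) by (intro eq_matI) (auto simp: colU orthonormal_vecs_def)
  have MU: "M * U = U * mat_diag k f"
  proof (rule mat_col_eqI)
    fix j assume "j < dim_col (U * mat_diag k f)"
    then have j: "j < k" by (simp add: mat_diag_def)
    have "col (M * U) j = lam (Suc j) \<cdot>\<^sub>v q (Suc j)"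
      using assms(5)[of "Suc j"] j col_mult2[OF M U j] by (simp add: colU eigenvector_def)
    also have "\<dots> = col (U * mat_diag k f) j"
      unfolding mat_diag_mult_right[OF U] colU[OF j, symmetric]
      using U j by (intro eq_vecI) (auto simp: f_def)
    finally show "col (M * U) j = col (U * mat_diag k f) j" .
  qed (use M U in \<open>auto simp: mat_diag_def\<close>)
  note proj = orthonormal_cols_projector[OF U UtU, folded assms(7)]
  have optimum: "approx_error M P_star = (\<Sum>i = k + 1..n. (lam i)\<^sup>2)"
    using approx_error_projector[OF M sym proj(1)]
      mat_trace_eigenvector_projector[OF M sym U UtU MU] trMM tail
    by (simp add: assms(7))
  have lower: "approx_error M P_star \<le> approx_error M P"
    if P: "orthogonal_projector n P" and rank: "vec_space.rank n P = k" for P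
  proof -
    have Pc: "P \<in> carrier_mat n n" "P * P = P" using P by (auto simp: orthogonal_projector_def)
    define G where "G = transpose_mat W * P * W"
    have G: "orthogonal_projector n G" "mat_trace G = mat_trace P"
      unfolding G_def using orthogonal_projector_conj[OF W WtW P] by auto
    \<comment> \<open>The rank constraint enters here, as the total of the weights.\<close>
    have "mat_trace G = real k"
      using G(2) vec_space.mat_trace_idempotent[OF Pc] rank by simp
    then have "(\<Sum>i<n. G $$ (i, i)) = real k"
      using G(1) by (auto simp: mat_trace_def orthogonal_projector_def)
    then have "(\<Sum>i<n. (f i)\<^sup>2 * G $$ (i, i)) \<le> (\<Sum>i<k. (f i)\<^sup>2)"
      using f2_anti projector_diag_bounds[OF G(1)] assms(1)
      by (intro weighted_sum_le_sum_largest) auto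
    then have "mat_trace (M * P * M) \<le> (\<Sum>i<k. (f i)\<^sup>2)"
      using mat_trace_diagonalized[OF W WtW MW Pc(1)] by (simp add: G_def)
    then show ?thesis
      using approx_error_projector[OF M sym P] optimum trMM tail by simp
  qed
  show ?thesis
    unfolding is_arg_min_linorder using proj lower optimum by (auto simp: assms(7))
qed

end
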